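(* For every finite colouring $\mathbb N=C_1\cup\dots\cup C_r$ and every $q\in\mathbb Q_{>0}$ there are $m\le r$ and a sequence $(x_i)_{i\in\mathbb N}$ of natural numbers such that $$\operatorname{FS}(x_i\mid i\in\mathbb N)\ \cup\ \left\{q\cdot\frac{\sum_{i\in G}x_i}{\sum_{i\in F}x_i}\ \middle|\ F,G\in\mathcal P_{\mathrm{fin}}(\mathbb N)\setminus\{\emptyset\},\ F<G\right\}\subseteq C_m.$$
   Context: $\mathbb N$ denotes the set of positive integers ($0\notin\mathbb N$). A finite colouring of $\mathbb N$ is a partition of $\mathbb N$ into finitely many pieces, called colours. $\mathcal P_{\mathrm{fin}}(\mathbb N)$ is the set of finite subsets of $\mathbb N$; for nonempty finite $F,G\subseteq\mathbb N$, $F<G$ means $\max F<\min G$. $\operatorname{FS}(x_i\mid i\in\mathbb N)=\{x_{i_1}+\dots+x_{i_k}\mid k\in\mathbb N,\ i_1<\dots<i_k\}$. *)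

theory Defs
  imports Complex_Main "HOL-Library.Disjoint_Sets"
begin

text \<open>
  The natural numbers here start at 1, both as values and as indices of sequences; a sequence
  is a function on \<open>nat\<close> whose value at 0 is never used.
\<close>

definition posnats :: "nat set" where
  "posnats = {n. 1 \<le> n}"

text \<open>Colour classes are disjoint and cover; as usual for colourings, some may be empty.\<close>

definition finite_colouring :: "nat \<Rightarrow> (nat \<Rightarrow> nat set) \<Rightarrow> bool" where
  "finite_colouring r C \<longleftrightarrow>
     (\<Union>i\<in>{1..r}. C i) = posnats \<and> disjoint_family_on C {1..r}"

definition FS :: "(nat \<Rightarrow> nat) \<Rightarrow> nat set" where
  "FS x = {\<Sum>j = 1..k. x (i j) | (k :: nat) i.
             1 \<le> k \<and> i ` {1..k} \<subseteq> posnats \<and> strict_mono_on {1..k} i}"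

definition finite_nonempty :: "nat set set" where
  "finite_nonempty = {F. finite F \<and> F \<subseteq> posnats} - {{}}"

definition set_before :: "nat set \<Rightarrow> nat set \<Rightarrow> bool" where
  "set_before F G \<longleftrightarrow> Max F < Min G"

end

theory Submission
  imports Defs
begin

text \<open>
  Let \<open>u\<close> be an idempotent ultrafilter for addition, containing every \<open>n\<nat>\<close>. The
  colour of \<open>q y / x\<close> is constant for \<open>u\<close>-most \<open>x\<close> and \<open>u\<close>-most \<open>y\<close>, and idempotence allows one to
  choose a sequence \<open>y\<close> such that \<open>q (\<Sum>\<^sub>G y) / (\<Sum>\<^sub>F y)\<close> has this colour whenever \<open>F < G\<close> (the
  two-dimensional Milliken--Taylor theorem). These ratios do not change when \<open>y\<close> is rescaled, so
  \<open>x i = q y i / y 0\<close> works: its finite sums are ratios with \<open>F = {0}\<close>.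
\<close>

section \<open>Idempotent ultrafilters\<close>

text \<open>Zorn's lemma for the reversed order on the members of \<open>A\<close> below
  \<open>a\<close>. The chains in the hypothesis are nonempty since \<open>Inf {}\<close> is
  \<open>top\<close>, which may lie outside \<open>A\<close>; \<open>a\<close> itself bounds the
  empty chain.\<close>

lemma Zorn_below:
  fixes A :: "'a::complete_lattice set"
  assumes "a \<in> A"
    and chain: "\<And>C. C \<noteq> {} \<Longrightarrow> C \<subseteq> A \<Longrightarrow> (\<And>x y. x \<in> C \<Longrightarrow> y \<in> C \<Longrightarrow> x \<le> y \<or> y \<le> x) \<Longrightarrow> Inf C \<in> A"
  shows "\<exists>m\<in>A. m \<le> a \<and> (\<forall>x\<in>A. x \<le> m \<longrightarrow> x = m)"
proof -
  let ?B = "{x \<in> A. x \<le> a}"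
  have "\<exists>m\<in>?B. \<forall>x\<in>?B. m \<ge> x \<longrightarrow> x = m"
  proof (rule predicate_Zorn)
    show "partial_order_on ?B (relation_of (\<ge>) ?B)"
      by (rule partial_order_on_relation_ofI) auto
  next
    fix C assume C: "C \<in> Chains (relation_of (\<ge>) ?B)"
    show "\<exists>l\<in>?B. \<forall>x\<in>C. x \<ge> l"
    proof (cases "C = {}")
      case True
      then show ?thesis using \<open>a \<in> A\<close> by auto
    next
      case False
      have sub: "C \<subseteq> ?B" and "\<And>x y. x \<in> C \<Longrightarrow> y \<in> C \<Longrightarrow> x \<le> y \<or> y \<le> x"
        using C by (auto simp: Chains_def relation_of_def)
      then have "Inf C \<in> A"
        using False by (intro chain) auto
      moreover obtain x where "x \<in> C" "x \<le> a"
        using False sub by blast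
      then have "Inf C \<le> a"
        by (rule Inf_lower2)
      ultimately show ?thesis
        by (auto intro: Inf_lower)
    qed
  qed
  then show ?thesis
    using order_trans by blast
qed

text \<open>The smaller of two members of a chain refines both, so a nonempty chain is a filter base
  and its infimum is the union of its filters.\<close>

lemma eventually_Inf_chain:
  fixes C :: "'a filter set"
  assumes "C \<noteq> {}" "\<And>F G. F \<in> C \<Longrightarrow> G \<in> C \<Longrightarrow> F \<le> G \<or> G \<le> F"
  shows "eventually P (Inf C) \<longleftrightarrow> (\<exists>F\<in>C. eventually P F)"
proof (rule eventually_Inf_base)
  fix F G assume "F \<in> C" "G \<in> C"
  then show "\<exists>H\<in>C. H \<le> inf F G"
    using assms(2)[of F G] by (metis inf.absorb1 inf.absorb2 order_refl)
qed (fact assms(1))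

text \<open>Compactness of the space of ultrafilters in filter form: nested nonempty closed sets
  have a common point.\<close>

lemma Inf_chain_neq_bot:
  fixes C :: "'a filter set"
  assumes "C \<noteq> {}" "\<And>F G. F \<in> C \<Longrightarrow> G \<in> C \<Longrightarrow> F \<le> G \<or> G \<le> F" "bot \<notin> C"
  shows "Inf C \<noteq> bot"
proof
  assume "Inf C = bot"
  then have "eventually (\<lambda>_. False) (Inf C)"
    by simp
  then obtain F where "F \<in> C" "eventually (\<lambda>_. False) F"
    using eventually_Inf_chain[OF assms(1,2)] by blast
  with assms(3) show False
    by (simp add: eventually_False)
qed

section \<open>Ultrafilters as minimal proper filters\<close>

definition ultra :: "'a filter \<Rightarrow> bool" where
  "ultra F \<longleftrightarrow> F \<noteq> bot \<and> (\<forall>P. eventually P F \<or> eventually (\<lambda>x. \<not> P x) F)"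

lemma ultra_eventually_not:
  assumes "ultra U"
  shows "eventually (\<lambda>x. \<not> P x) U \<longleftrightarrow> \<not> eventually P U"
proof
  assume "eventually (\<lambda>x. \<not> P x) U"
  show "\<not> eventually P U"
  proof
    assume "eventually P U"
    with \<open>eventually (\<lambda>x. \<not> P x) U\<close> have "eventually (\<lambda>_. False) U"
      by eventually_elim simp
    with assms show False
      by (simp add: ultra_def eventually_False)
  qed
qed (use assms in \<open>auto simp: ultra_def\<close>)

lemma ultra_below:
  assumes "F \<noteq> bot"
  obtains U where "ultra U" "U \<le> F"
proof -
  have "\<exists>U\<in>- {bot}. U \<le> F \<and> (\<forall>G\<in>- {bot}. G \<le> U \<longrightarrow> G = U)"
  proof (rule Zorn_below[of F "- {bot}"])
    fix C :: "'a filter set"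
    assume "C \<noteq> {}" "C \<subseteq> - {bot}" "\<And>F G. F \<in> C \<Longrightarrow> G \<in> C \<Longrightarrow> F \<le> G \<or> G \<le> F"
    then show "Inf C \<in> - {bot}"
      using Inf_chain_neq_bot[of C] by auto
  qed (use assms in simp)
  then obtain U where U: "U \<noteq> bot" "U \<le> F" and min: "\<And>G. G \<noteq> bot \<Longrightarrow> G \<le> U \<Longrightarrow> G = U"
    by (metis ComplD ComplI singletonI singletonD)
  have "eventually P U \<or> eventually (\<lambda>x. \<not> P x) U" for P
  proof (rule disjCI)
    assume "\<not> eventually (\<lambda>x. \<not> P x) U"
    \<comment> \<open>Adding \<open>P\<close> to \<open>U\<close> keeps the filter proper, so by
      minimality it adds nothing: \<open>P\<close> was already in \<open>U\<close>.\<close>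
    then have "inf U (principal {x. P x}) \<noteq> bot"
      by (simp add: trivial_limit_def eventually_inf_principal)
    then have "inf U (principal {x. P x}) = U"
      using min by simp
    then have "eventually P U \<longleftrightarrow> eventually (\<lambda>x. x \<in> {x. P x} \<longrightarrow> P x) U"
      by (metis eventually_inf_principal)
    then show "eventually P U"
      by simp
  qed
  with U show thesis
    using that by (auto simp: ultra_def)
qed

text \<open>On ultrafilters this is the addition of the Stone-Cech compactification; the order of
  the quantifiers matters even for commutative \<open>+\<close>.\<close>

definition conv :: "'a::plus filter \<Rightarrow> 'a filter \<Rightarrow> 'a filter" where
  "conv F G = Abs_filter (\<lambda>P. \<forall>\<^sub>F x in F. \<forall>\<^sub>F y in G. P (x + y))"

lemma eventually_conv:
  "eventually P (conv F G) \<longleftrightarrow> (\<forall>\<^sub>F x in F. \<forall>\<^sub>F y in G. P (x + y))"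
  unfolding conv_def
proof (rule eventually_Abs_filter, rule is_filter.intro)
  fix P Q :: "'a \<Rightarrow> bool"
  assume "\<forall>x. P x \<longrightarrow> Q x" "\<forall>\<^sub>F x in F. \<forall>\<^sub>F y in G. P (x + y)"
  then show "\<forall>\<^sub>F x in F. \<forall>\<^sub>F y in G. Q (x + y)"
    by (auto elim!: eventually_mono)
qed (auto simp: eventually_conj_iff)

lemma conv_assoc:
  fixes F G H :: "'a::semigroup_add filter"
  shows "conv (conv F G) H = conv F (conv G H)"
  by (simp add: filter_eq_iff eventually_conv add.assoc)

lemma conv_mono: "F \<le> F' \<Longrightarrow> G \<le> G' \<Longrightarrow> conv F G \<le> conv F' G'"
  unfolding le_filter_def eventually_conv by (auto elim!: eventually_mono)

lemma conv_eq_bot_iff: "conv F G = bot \<longleftrightarrow> F = bot \<or> G = bot"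
  by (cases "G = bot") (simp_all add: trivial_limit_def eventually_conv)

text \<open>
  Instead of a minimal closed subsemigroup of the space of ultrafilters, as in the Ellis--Numakura
  lemma, we take a minimal filter that is a subsemigroup.
\<close>

theorem idempotent_ultra_below:
  fixes F :: "'a::semigroup_add filter"
  assumes "F \<noteq> bot" "conv F F \<le> F"
  obtains U where "ultra U" "U \<le> F" "conv U U = U"
proof -
  define A :: "'a filter set" where "A = {F. F \<noteq> bot \<and> conv F F \<le> F}"
  have "\<exists>U\<in>A. U \<le> F \<and> (\<forall>G\<in>A. G \<le> U \<longrightarrow> G = U)"
  proof (rule Zorn_below[of F A])
    show "F \<in> A" using assms by (simp add: A_def)
  next
    fix C :: "'a filter set"
    assume C: "C \<noteq> {}" "C \<subseteq> A" "\<And>F G. F \<in> C \<Longrightarrow> G \<in> C \<Longrightarrow> F \<le> G \<or> G \<le> F"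
    then have "Inf C \<noteq> bot"
      using Inf_chain_neq_bot[of C] by (auto simp: A_def)
    moreover have "conv (Inf C) (Inf C) \<le> G" if "G \<in> C" for G
      using that C(2) conv_mono[OF Inf_lower Inf_lower, OF that that]
      by (auto simp: A_def intro: order_trans)
    ultimately show "Inf C \<in> A"
      by (simp add: A_def le_Inf_iff)
  qed
  then obtain U where U: "U \<in> A" "U \<le> F" and min: "\<And>G. G \<in> A \<Longrightarrow> G \<le> U \<Longrightarrow> G = U"
    by blast
  have "U \<noteq> bot" and UU_le: "conv U U \<le> U"
    using U by (auto simp: A_def)
  have "conv U U \<in> A"
    using \<open>U \<noteq> bot\<close> UU_le by (simp add: A_def conv_eq_bot_iff conv_mono)
  then have UU: "conv U U = U"
    using min UU_le by blast
  obtain p where p: "ultra p" "p \<le> U"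
    using ultra_below \<open>U \<noteq> bot\<close> by blast
  then have "p \<noteq> bot" by (simp add: ultra_def)
  \<comment> \<open>If \<open>S\<close> is the closed set of ultrafilters below \<open>U\<close>,
    then \<open>conv U p\<close> stands for the closed set \<open>S + p\<close>, again a
    subsemigroup inside \<open>S\<close>.\<close>
  have "conv U p = U"
  proof (rule min)
    show le: "conv U p \<le> U"
      using conv_mono[OF order_refl p(2), of U] UU by simp
    have "conv (conv U p) (conv U p) = conv U (conv (conv p U) p)"
      by (simp add: conv_assoc)
    also have "\<dots> \<le> conv U (conv U p)"
      using conv_mono[OF p(2) order_refl, of U] UU by (intro conv_mono) auto
    also have "\<dots> = conv U p"
      by (simp add: UU flip: conv_assoc)
    finally show "conv U p \<in> A"
      using \<open>U \<noteq> bot\<close> \<open>p \<noteq> bot\<close> by (simp add: A_def conv_eq_bot_iff)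
  qed
  \<comment> \<open>The filter below is the closed subsemigroup of all \<open>v \<le> U\<close> with \<open>conv v p = p\<close>.\<close>
  define S where "S = (\<lambda>P. \<exists>Q. eventually Q p \<and> (\<forall>\<^sub>F x in U. (\<forall>\<^sub>F y in p. Q (x + y)) \<longrightarrow> P x))"
  define E where "E = Abs_filter S"
  have "is_filter S"
  proof
    fix P Q assume "S P" "S Q"
    then obtain P' Q' where "eventually P' p" "\<forall>\<^sub>F x in U. (\<forall>\<^sub>F y in p. P' (x + y)) \<longrightarrow> P x"
      "eventually Q' p" "\<forall>\<^sub>F x in U. (\<forall>\<^sub>F y in p. Q' (x + y)) \<longrightarrow> Q x"
      by (auto simp: S_def)
    then have "eventually (\<lambda>x. P' x \<and> Q' x) p"
      "\<forall>\<^sub>F x in U. (\<forall>\<^sub>F y in p. P' (x + y) \<and> Q' (x + y)) \<longrightarrow> P x \<and> Q x"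
      by (auto elim: eventually_elim2 simp: eventually_conj_iff)
    then show "S (\<lambda>x. P x \<and> Q x)"
      unfolding S_def by (intro exI[of _ "\<lambda>x. P' x \<and> Q' x"]) simp
  next
    fix P Q :: "'a \<Rightarrow> bool" assume "\<forall>x. P x \<longrightarrow> Q x" "S P"
    then show "S Q"
      unfolding S_def by (auto elim!: eventually_mono)
  qed (auto simp: S_def intro: exI[of _ "\<lambda>_. True"])
  then have E: "eventually P E \<longleftrightarrow> S P" for P
    by (simp add: E_def eventually_Abs_filter)
  have E_p: "\<forall>\<^sub>F x in E. \<forall>\<^sub>F y in p. Q (x + y)" if "eventually Q p" for Q
    using that by (auto simp: E S_def)
  have "E = U"
  proof (rule min)
    show "E \<le> U"
      by (rule filter_leI) (auto simp: E S_def intro!: exI[of _ "\<lambda>_. True"])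
    \<comment> \<open>Since \<open>p \<le> U = conv U p\<close>, some ultrafilter below
      \<open>U\<close> carries \<open>p\<close> to itself. In terms of sets: otherwise the
      complement of some \<open>Q\<close> in \<open>p\<close> would lie in \<open>conv U p\<close>,
      hence in \<open>p\<close>.\<close>
    have "E \<noteq> bot"
    proof
      assume "E = bot"
      then obtain Q where Q: "eventually Q p" "\<forall>\<^sub>F x in U. \<not> (\<forall>\<^sub>F y in p. Q (x + y))"
        by (auto simp: trivial_limit_def E S_def)
      then have "\<forall>\<^sub>F x in U. \<forall>\<^sub>F y in p. \<not> Q (x + y)"
        by (simp add: ultra_eventually_not[OF \<open>ultra p\<close>])
      then have "eventually (\<lambda>x. \<not> Q x) U"
        using eventually_conv[of "\<lambda>x. \<not> Q x" U p] \<open>conv U p = U\<close> by simp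
      then have "eventually (\<lambda>x. \<not> Q x) p"
        using \<open>p \<le> U\<close> by (simp add: filter_leD)
      with Q(1) show False
        by (simp add: ultra_eventually_not[OF \<open>ultra p\<close>])
    qed
    moreover have "eventually P (conv E E)" if "eventually P E" for P
    proof -
      from that obtain Q where Q: "eventually Q p" "\<forall>\<^sub>F x in U. (\<forall>\<^sub>F y in p. Q (x + y)) \<longrightarrow> P x"
        by (auto simp: E S_def)
      from Q(2) have "\<forall>\<^sub>F x in conv E E. (\<forall>\<^sub>F y in p. Q (x + y)) \<longrightarrow> P x"
        using conv_mono[OF \<open>E \<le> U\<close> \<open>E \<le> U\<close>] UU by (simp add: filter_leD)
      \<comment> \<open>If \<open>v\<close> and \<open>w\<close> both fix \<open>p\<close> by
        translation, so does their sum: \<open>E_p\<close> is applied to \<open>Q\<close> and then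
        to its translates.\<close>
      moreover have "\<forall>\<^sub>F x in conv E E. \<forall>\<^sub>F y in p. Q (x + y)"
        unfolding eventually_conv add.assoc
        using E_p[OF Q(1)] by eventually_elim (rule E_p)
      ultimately show ?thesis
        by eventually_elim simp
    qed
    ultimately show "E \<in> A"
      by (simp add: A_def filter_leI)
  qed
  \<comment> \<open>By \<open>E = U\<close>, everything below \<open>U\<close> fixes
    \<open>p\<close>, in particular \<open>p\<close> itself; minimality of \<open>U\<close> then
    forces \<open>p = U\<close>.\<close>
  have "conv p p \<le> p"
  proof (rule filter_leI)
    fix P assume "eventually P p"
    then have "\<forall>\<^sub>F x in U. \<forall>\<^sub>F y in p. P (x + y)"
      using E_p \<open>E = U\<close> by simp
    then show "eventually P (conv p p)"
      using \<open>p \<le> U\<close> by (simp add: eventually_conv filter_leD)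
  qed
  then have "p = U"
    using min p \<open>p \<noteq> bot\<close> by (simp add: A_def)
  with p \<open>U \<le> F\<close> UU show thesis
    using that by blast
qed

text \<open>The pigeonhole principle for ultrafilters, used to select colours.\<close>

lemma ultra_eventually_finite_Un:
  assumes "ultra U" "finite I" "\<forall>\<^sub>F x in U. \<exists>i\<in>I. P i x"
  shows "\<exists>i\<in>I. eventually (P i) U"
proof (rule ccontr)
  assume "\<not> ?thesis"
  then have "\<forall>\<^sub>F x in U. \<forall>i\<in>I. \<not> P i x"
    using assms by (simp add: eventually_ball_finite_distrib ultra_eventually_not)
  with assms(3) have "\<forall>\<^sub>F x in U. False"
    by eventually_elim blast
  with \<open>ultra U\<close> show False
    by (simp add: ultra_def eventually_False)
qed

section \<open>Sums over blocks\<close>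

lemma sum_insert_Max:
  fixes y :: "nat \<Rightarrow> 'a::comm_monoid_add"
  assumes "finite F" "F \<noteq> {}"
  shows "sum y F = sum y (F - {Max F}) + y (Max F)"
  using assms by (subst sum.remove[of F "Max F"]) (auto simp: add.commute)

lemma remove_Max_subset:
  fixes F :: "'a::linorder set"
  assumes "finite F"
  shows "F - {Max F} \<subseteq> {..<Max F}"
  using assms by (auto simp: less_le)

text \<open>The Galvin-Glazer construction in both coordinates: terms are chosen one by one so that
  all block sums so far stay in \<open>U\<close>-large sets that \<open>U\<close>-most further terms
  do not leave.\<close>

theorem Milliken_Taylor_pairs:
  fixes U :: "'a::comm_monoid_add filter"
  assumes "U \<noteq> bot" "conv U U = U" and R: "\<forall>\<^sub>F x in U. \<forall>\<^sub>F y in U. R x y"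
  obtains y :: "nat \<Rightarrow> 'a" where
    "\<And>F G. finite F \<Longrightarrow> finite G \<Longrightarrow> F \<noteq> {} \<Longrightarrow> G \<noteq> {} \<Longrightarrow> Max F < Min G \<Longrightarrow> R (sum y F) (sum y G)"
proof -
  \<comment> \<open>The usual \<open>A*\<close> of an idempotent: it is again
    \<open>U\<close>-large, and unlike \<open>P\<close> it is preserved by adding
    \<open>U\<close>-most \<open>z\<close> (\<open>star_shift\<close>).\<close>
  define star where "star P x \<longleftrightarrow> P x \<and> (\<forall>\<^sub>F z in U. P (x + z))" for P and x :: 'a
  have shift: "\<forall>\<^sub>F x in U. \<forall>\<^sub>F z in U. P (x + z)" if "eventually P U" for P
    using that \<open>conv U U = U\<close> by (metis eventually_conv)
  have star: "eventually (star P) U" if "eventually P U" for P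
    using that shift[OF that] unfolding star_def by eventually_elim simp
  have star_shift: "\<forall>\<^sub>F z in U. star P (x + z)" if "star P x" for P x
    using that shift[of "\<lambda>z. P (x + z)"] by (auto simp: star_def add.assoc eventually_conj_iff)
  define B where "B = star (\<lambda>x. \<forall>\<^sub>F y in U. R x y)"
  \<comment> \<open>\<open>z\<close> is admissible as term \<open>n\<close> after the terms of
    \<open>f\<close> below \<open>n\<close>: it may end a first block (\<open>B\<close>) or a second
    block. Empty \<open>F\<close> in the former and empty \<open>G\<close> in the latter let
    \<open>z\<close> start the block.\<close>
  define step where "step f n z \<longleftrightarrow>
      (\<forall>F. F \<subseteq> {..<n} \<longrightarrow> B (sum f F + z)) \<and>
      (\<forall>F G. F \<subseteq> {..<n} \<longrightarrow> G \<subseteq> {..<n} \<longrightarrow> F \<noteq> {} \<longrightarrow> (\<forall>i\<in>F. \<forall>j\<in>G. i < j) \<longrightarrow>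
        star (R (sum f F)) (sum f G + z))" for f and n :: nat and z
  \<comment> \<open>The condition imposed when the last term of the block was chosen, at
    \<open>n = Max F\<close>, covers the whole sum; \<open>step_R\<close> does the same at
    \<open>Max G\<close>.\<close>
  have step_B: "B (sum f F)"
    if "\<And>n. n < N \<Longrightarrow> step f n (f n)" "F \<subseteq> {..<N}" "F \<noteq> {}" for f N F
  proof -
    have "finite F" using that(2) finite_subset by blast
    then have "Max F < N"
      using that(2) Max_in[OF _ that(3)] by blast
    with that(1) have "step f (Max F) (f (Max F))"
      by blast
    then show ?thesis
      using remove_Max_subset[OF \<open>finite F\<close>]
      by (simp add: sum_insert_Max[OF \<open>finite F\<close> that(3)] step_def)
  qed
  have step_R: "star (R (sum f F)) (sum f G)"
    if "\<And>n. n < N \<Longrightarrow> step f n (f n)" "F \<subseteq> {..<N}" "G \<subseteq> {..<N}" "F \<noteq> {}" "G \<noteq> {}"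
      "\<forall>i\<in>F. \<forall>j\<in>G. i < j" for f N F G
  proof -
    have "finite G" using that(3) finite_subset by blast
    then have "Max G \<in> G"
      using that(5) by (rule Max_in)
    then have "Max G < N" "F \<subseteq> {..<Max G}"
      using that(3,6) by auto
    with that(1) have "step f (Max G) (f (Max G))"
      by blast
    then show ?thesis
      using remove_Max_subset[OF \<open>finite G\<close>] \<open>F \<subseteq> {..<Max G}\<close> that(4,6)
      by (simp add: sum_insert_Max[OF \<open>finite G\<close> that(5)] step_def)
  qed
  have "\<exists>f. \<forall>n. step f n (f n)"
  proof (rule dependent_wellorder_choice)
    fix r and f g :: "nat \<Rightarrow> 'a" and n
    assume "\<And>k. k < n \<Longrightarrow> f k = g k"
    then have "sum f F = sum g F" if "F \<subseteq> {..<n}" for F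
      using that by (intro sum.cong) auto
    then show "step f n r = step g n r"
      by (simp add: step_def)
  next
    fix n f assume IH: "\<And>k. k < n \<Longrightarrow> step f k (f k)"
    have ev_B: "\<forall>\<^sub>F z in U. B (sum f F + z)" if "F \<subseteq> {..<n}" for F
      using star[OF R] star_shift step_B[OF IH that] by (cases "F = {}") (auto simp: B_def)
    have ev_R: "\<forall>\<^sub>F z in U. star (R (sum f F)) (sum f G + z)"
      if "F \<subseteq> {..<n}" "G \<subseteq> {..<n}" "F \<noteq> {}" "\<forall>i\<in>F. \<forall>j\<in>G. i < j" for F G
    proof (cases "G = {}")
      case True
      \<comment> \<open>A second block starts here; \<open>B\<close> was imposed on
        \<open>sum f F\<close> exactly so that \<open>U\<close>-most terms can start one.\<close>
      have "eventually (R (sum f F)) U"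
        using step_B[OF IH that(1,3)] by (simp add: B_def star_def)
      with True show ?thesis
        by (simp add: star)
    next
      case False
      then show ?thesis
        using step_R[OF IH that(1-3) False that(4)] star_shift by blast
    qed
    have "\<forall>\<^sub>F z in U. F \<noteq> {} \<longrightarrow> (\<forall>i\<in>F. \<forall>j\<in>G. i < j) \<longrightarrow> star (R (sum f F)) (sum f G + z)"
      if "F \<in> Pow {..<n}" "G \<in> Pow {..<n}" for F G
      using that ev_R[of F G] by (cases "F \<noteq> {} \<and> (\<forall>i\<in>F. \<forall>j\<in>G. i < j)") (auto elim: eventually_mono)
    \<comment> \<open>Only finitely many blocks lie below \<open>n\<close>, so all conditions hold
      together for \<open>U\<close>-most \<open>z\<close>.\<close>
    then have "\<forall>\<^sub>F z in U. (\<forall>F\<in>Pow {..<n}. B (sum f F + z)) \<and>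
        (\<forall>F\<in>Pow {..<n}. \<forall>G\<in>Pow {..<n}. F \<noteq> {} \<longrightarrow> (\<forall>i\<in>F. \<forall>j\<in>G. i < j) \<longrightarrow>
          star (R (sum f F)) (sum f G + z))"
      using ev_B by (intro eventually_conj eventually_ball_finite ballI) simp_all
    then obtain z where "(\<forall>F\<in>Pow {..<n}. B (sum f F + z)) \<and>
        (\<forall>F\<in>Pow {..<n}. \<forall>G\<in>Pow {..<n}. F \<noteq> {} \<longrightarrow> (\<forall>i\<in>F. \<forall>j\<in>G. i < j) \<longrightarrow>
          star (R (sum f F)) (sum f G + z))"
      using eventually_happens'[OF \<open>U \<noteq> bot\<close>] by blast
    then have "step f n z"
      unfolding step_def Pow_iff Ball_def by blast
    then show "\<exists>z. step f n z" ..
  qed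
  then obtain f where f: "\<And>n. step f n (f n)" by blast
  show thesis
  proof (rule that)
    fix F G :: "nat set"
    assume FG: "finite F" "finite G" "F \<noteq> {}" "G \<noteq> {}" "Max F < Min G"
    then have "\<forall>i\<in>F. \<forall>j\<in>G. i < j"
      by (meson Max_ge Min_le le_less_trans less_le_trans)
    moreover have "F \<subseteq> {..<Suc (Max (F \<union> G))}" "G \<subseteq> {..<Suc (Max (F \<union> G))}"
      using FG by (auto simp: less_Suc_eq_le)
    ultimately show "R (sum f F) (sum f G)"
      using step_R[OF f] FG(3,4) by (auto simp: star_def)
  qed
qed

section \<open>Monochromatic ratios\<close>

text \<open>The positive multiples of \<open>n\<close> form a subsemigroup, so the filter they
  generate satisfies \<open>conv F F \<le> F\<close>. Positivity excludes the principal ultrafilter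
  at 0, a useless idempotent.\<close>

lemma idempotent_ultra_divisible:
  obtains U :: "nat filter" where "ultra U" "conv U U = U"
    "\<And>n. n > 0 \<Longrightarrow> \<forall>\<^sub>F x in U. x > 0 \<and> n dvd x"
proof -
  define M :: "nat \<Rightarrow> nat set" where "M n = {x. x > 0 \<and> n dvd x}" for n
  define F where "F = (INF n\<in>{0<..}. principal (M n))"
  have F: "eventually P F \<longleftrightarrow> (\<exists>n>0. \<forall>x\<in>M n. P x)" for P
    unfolding F_def
  proof (subst eventually_INF_base)
    fix a b :: nat assume "a \<in> {0<..}" "b \<in> {0<..}"
    then show "\<exists>n\<in>{0<..}. principal (M n) \<le> inf (principal (M a)) (principal (M b))"
      by (intro bexI[of _ "a * b"]) (auto simp: M_def elim: dvd_mult_left dvd_mult_right)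
  qed (auto simp: eventually_principal)
  have "F \<noteq> bot"
    by (auto simp: trivial_limit_def F M_def)
  moreover have "conv F F \<le> F"
  proof (rule filter_leI)
    fix P assume "eventually P F"
    then obtain n where n: "n > 0" "\<And>x. x \<in> M n \<Longrightarrow> P x"
      by (auto simp: F)
    have "P (x + y)" if "x \<in> M n" "y \<in> M n" for x y
      using that by (intro n(2)) (auto simp: M_def)
    then show "eventually P (conv F F)"
      using n(1) unfolding eventually_conv F by blast
  qed
  ultimately obtain U where U: "ultra U" "U \<le> F" "conv U U = U"
    by (rule idempotent_ultra_below)
  have "\<forall>\<^sub>F x in U. x > 0 \<and> n dvd x" if "n > 0" for n
    using that by (intro filter_leD[OF U(2)]) (auto simp: F M_def)
  with U show thesis
    using that by blast
qed

lemma monochromatic_ratios: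
  fixes C :: "nat \<Rightarrow> nat set" and q :: rat
  assumes "finite_colouring r C" "q > 0"
  obtains m and y :: "nat \<Rightarrow> nat" where "m \<in> {1..r}"
    "\<And>F G. finite F \<Longrightarrow> finite G \<Longrightarrow> F \<noteq> {} \<Longrightarrow> G \<noteq> {} \<Longrightarrow> Max F < Min G \<Longrightarrow>
      q * of_nat (sum y G) / of_nat (sum y F) \<in> (of_nat ` C m :: rat set)"
proof -
  obtain U :: "nat filter" where U: "ultra U" "conv U U = U"
    and dvd: "\<And>n. n > 0 \<Longrightarrow> \<forall>\<^sub>F x in U. x > 0 \<and> n dvd x"
    using idempotent_ultra_divisible by metis
  obtain a b :: int where ab: "q = of_int a / of_int b" "a > 0" "b > 0"
    using \<open>q > 0\<close> by (cases q) (auto simp: Fract_of_int_quotient zero_less_divide_iff)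
  define a' b' where "a' = nat a" "b' = nat b"
  with ab have q: "q = of_nat a' / of_nat b'" "a' > 0" "b' > 0"
    by (auto simp: of_nat_nat)
  define R where "R m x y \<longleftrightarrow> q * of_nat y / of_nat x \<in> (of_nat ` C m :: rat set)"
    for m and x y :: nat
  \<comment> \<open>Divisibility by \<open>b' * x\<close> cancels both denominators, so the ratio is
    a positive integer and has a colour.\<close>
  have covers: "\<exists>m\<in>{1..r}. R m x y" if xy: "x > 0" "y > 0" "b' * x dvd y" for x y
  proof -
    obtain k where k: "y = b' * x * k" using xy(3) by blast
    then have "a' * k \<in> posnats"
      using xy q by (auto simp: posnats_def Suc_le_eq)
    then obtain m where "m \<in> {1..r}" "a' * k \<in> C m"
      using assms(1) unfolding finite_colouring_def by blast
    moreover have "q * of_nat y / of_nat x = of_nat (a' * k)"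
      using k q xy by (simp add: field_simps)
    ultimately show ?thesis
      unfolding R_def by blast
  qed
  have "\<forall>\<^sub>F x in U. x > 0"
    using dvd[of 1] by simp
  \<comment> \<open>Pigeonhole over \<open>y\<close> gives a colour depending on \<open>x\<close>; a
    second pigeonhole over \<open>x\<close> makes it constant.\<close>
  then have "\<forall>\<^sub>F x in U. \<exists>m\<in>{1..r}. \<forall>\<^sub>F y in U. R m x y"
  proof eventually_elim
    case (elim x)
    then have "\<forall>\<^sub>F y in U. y > 0 \<and> b' * x dvd y"
      using q by (intro dvd) auto
    then have "\<forall>\<^sub>F y in U. \<exists>m\<in>{1..r}. R m x y"
      by eventually_elim (use covers elim in auto)
    then show ?case
      using ultra_eventually_finite_Un[OF U(1)] by fastforce
  qed
  then obtain m where m: "m \<in> {1..r}" "\<forall>\<^sub>F x in U. \<forall>\<^sub>F y in U. R m x y"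
    using ultra_eventually_finite_Un[OF U(1), of "{1..r}" "\<lambda>m x. \<forall>\<^sub>F y in U. R m x y"] by auto
  have "U \<noteq> bot" using U(1) by (simp add: ultra_def)
  then show thesis
  proof (rule Milliken_Taylor_pairs[OF _ U(2) m(2)])
    fix y :: "nat \<Rightarrow> nat"
    assume y: "\<And>F G. finite F \<Longrightarrow> finite G \<Longrightarrow> F \<noteq> {} \<Longrightarrow> G \<noteq> {} \<Longrightarrow> Max F < Min G \<Longrightarrow>
      R m (sum y F) (sum y G)"
    show thesis
      by (rule that[OF m(1)]) (rule y[unfolded R_def])
  qed
qed

section \<open>From ratios to finite sums by rescaling\<close>

lemma FS_subset_block_sums: "FS x \<subseteq> sum x ` finite_nonempty"
proof
  fix s assume "s \<in> FS x"
  then obtain k :: nat and i where s: "s = (\<Sum>j = 1..k. x (i j))" and k: "1 \<le> k"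
    and i: "i ` {1..k} \<subseteq> posnats" "strict_mono_on {1..k} i"
    unfolding FS_def by blast
  have "s = sum x (i ` {1..k})"
    unfolding s using strict_mono_on_imp_inj_on[OF i(2)] by (simp add: sum.reindex)
  moreover have "i ` {1..k} \<in> finite_nonempty"
    using k i(1) by (auto simp: finite_nonempty_def)
  ultimately show "s \<in> sum x ` finite_nonempty"
    by blast
qed

theorem corollary1p6:
  fixes C :: "nat \<Rightarrow> nat set" and r :: nat and q :: rat
  assumes "finite_colouring r C"
    and "q > 0"
  shows "\<exists>m\<in>{1..r}. \<exists>x :: nat \<Rightarrow> nat. (\<forall>i\<in>posnats. x i \<in> posnats) \<and>
    of_nat ` FS x \<union>
      {q * (of_nat (\<Sum>i\<in>G. x i) / of_nat (\<Sum>i\<in>F. x i)) | F G.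
         F \<in> finite_nonempty \<and> G \<in> finite_nonempty \<and> set_before F G}
    \<subseteq> (of_nat ` C m :: rat set)"
proof -
  obtain m and y :: "nat \<Rightarrow> nat" where m: "m \<in> {1..r}" and
    y: "\<And>F G. finite F \<Longrightarrow> finite G \<Longrightarrow> F \<noteq> {} \<Longrightarrow> G \<noteq> {} \<Longrightarrow> Max F < Min G \<Longrightarrow>
      q * of_nat (sum y G) / of_nat (sum y F) \<in> (of_nat ` C m :: rat set)"
    using monochromatic_ratios[OF assms] by metis
  have pos: "C m \<subseteq> posnats"
    using assms(1) m by (auto simp: finite_colouring_def)
  \<comment> \<open>Indices of \<open>x\<close> start at 1, so \<open>{0}\<close> precedes every
    admissible block and \<open>y 0\<close> is free to serve as the denominator.\<close>
  define t where "t = q / of_nat (y 0)"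
  have "\<exists>k\<in>C m. of_nat k = t * of_nat (y i)" if "i \<in> posnats" for i
    using y[of "{0}" "{i}"] that by (auto simp: posnats_def t_def)
  then obtain x where x: "\<And>i. i \<in> posnats \<Longrightarrow> x i \<in> C m \<and> of_nat (x i) = t * of_nat (y i)"
    by metis
  have sum_x: "of_nat (sum x F) = t * of_nat (sum y F)" if "F \<in> finite_nonempty" for F
  proof -
    have "of_nat (sum x F) = (\<Sum>i\<in>F. t * of_nat (y i))"
      using that x by (auto simp: finite_nonempty_def intro!: sum.cong)
    then show ?thesis
      by (simp add: sum_distrib_left)
  qed
  \<comment> \<open>As \<open>x 1\<close> is a colour member it is positive. This rules out
    \<open>y 0 = 0\<close>, where division yields 0, and lets \<open>t\<close> cancel in the
    ratios.\<close>
  have "t \<noteq> 0"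
    using x[of 1] pos by (auto simp: posnats_def)
  have "of_nat (sum x F) \<in> (of_nat ` C m :: rat set)" if "F \<in> finite_nonempty" for F
    using that y[of "{0}" F] unfolding sum_x[OF that]
    by (auto simp: t_def finite_nonempty_def posnats_def Suc_le_eq)
  then have "of_nat ` FS x \<subseteq> (of_nat ` C m :: rat set)"
    using FS_subset_block_sums by blast
  moreover have "q * (of_nat (sum x G) / of_nat (sum x F)) \<in> (of_nat ` C m :: rat set)"
    if "F \<in> finite_nonempty" "G \<in> finite_nonempty" "set_before F G" for F G
    using that y[of F G] \<open>t \<noteq> 0\<close> unfolding sum_x[OF that(1)] sum_x[OF that(2)]
    by (auto simp: finite_nonempty_def set_before_def)
  ultimately show ?thesis
    using m x pos by (intro bexI[of _ m] exI[of _ x]) auto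
qed

end
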